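(* Let $q$ be an odd prime power, let $d$ be a positive integer with $q \equiv -1 \pmod d$, and let $c \in \mathbb{F}_{q^2}^*$. Let $r$ be a positive integer, let $k$ be an integer, and write $v=\frac{q+1}{d}$ and $v_1=(d-1)v$, where the exponents $v_1+k$ and $qv+k$ are supposed nonnegative. Let $$h(x)=c+x^{v_1+k}-x^{qv+k}\in\mathbb{F}_{q^2}[x].$$ Then $f(x)=x^r h(x^{q-1})$ is a permutation polynomial of $\mathbb{F}_{q^2}$ if and only if $\gcd(r,q^2-1)=1$.
   Context: $\mathbb{F}_{q^2}$ denotes the finite field with $q^2$ elements and $\mathbb{F}_{q^2}^*$ its set of nonzero elements. A polynomial $f\in\mathbb{F}_{q^2}[x]$ is a permutation polynomial of $\mathbb{F}_{q^2}$ if the map $a\mapsto f(a)$ from $\mathbb{F}_{q^2}$ to itself is a bijection. *)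

theory Defs
  imports "HOL-Number_Theory.Number_Theory" "HOL-Computational_Algebra.Polynomial"
    "HOL-Library.Cardinality"
begin

definition permutation_polynomial :: "'a::{finite,field} poly \<Rightarrow> bool" where
  "permutation_polynomial f \<longleftrightarrow> bij (poly f)"

end

theory Submission
  imports Defs
begin

text \<open>
  The two exponents of \<open>x\<close> in \<open>h\<close> differ by \<open>(q + 1) (v - 1)\<close>, and \<open>x ^ (q - 1)\<close> is a \<open>(q + 1)\<close>-th
  root of unity for \<open>x \<noteq> 0\<close>. So the two monomials cancel and \<open>f\<close> induces the map
  \<open>x \<mapsto> c x\<^sup>r\<close>. If \<open>g = gcd r (q\<^sup>2 - 1)\<close> and \<open>x \<mapsto> x\<^sup>r\<close> is injective, then
  \<open>x \<mapsto> x ^ ((q\<^sup>2 - 1) / g)\<close> is constantly \<open>1\<close> on the nonzero elements, and counting the roots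
  of a polynomial forces \<open>g = 1\<close>.
\<close>

text \<open>Multiplication by \<open>x\<close> permutes the nonzero elements, so it leaves their
  product unchanged; that product is nonzero and cancels.\<close>

lemma finite_field_power_eq_1:
  fixes x :: "'a::{finite,field}"
  assumes "x \<noteq> 0"
  shows "x ^ (CARD('a) - 1) = 1"
proof -
  let ?U = "UNIV - {0::'a}"
  have "bij_betw ((*) x) ?U ?U"
    by (rule bij_betw_byWitness[where f' = "\<lambda>y. y / x"]) (use assms in auto)
  then have "\<Prod>?U = (\<Prod>y\<in>?U. x * y)"
    by (rule prod.reindex_bij_betw[symmetric])
  also have "\<dots> = x ^ (CARD('a) - 1) * \<Prod>?U"
    by (simp add: prod.distrib card_Diff_singleton)
  finally show ?thesis
    by (simp add: prod_zero_iff)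
qed

text \<open>Bezout in subtraction-free form; \<open>bezout_nat\<close> requires \<open>m\<close> to
  be nonzero, hence the case split.\<close>

lemma power_gcd_eq_1:
  fixes x :: "'a::field"
  assumes "x ^ m = 1" "x ^ n = 1"
  shows "x ^ gcd m n = 1"
proof (cases "m = 0")
  case False
  then obtain a b where "m * a = n * b + gcd m n"
    using bezout_nat by blast
  then have "(x ^ m) ^ a = (x ^ n) ^ b * x ^ gcd m n"
    by (simp flip: power_mult power_add)
  with assms show ?thesis by simp
qed (use assms in simp)

text \<open>Every nonzero element is a root of x^m - 1, a nonzero polynomial of degree at most
  \<open>m\<close>.\<close>

lemma finite_field_exponent_ge:
  assumes "m > 0" and "\<And>x::'a::{finite,field}. x \<noteq> 0 \<Longrightarrow> x ^ m = 1"
  shows "CARD('a) - 1 \<le> m"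
proof -
  let ?p = "monom 1 m - 1 :: 'a poly"
  have deg: "degree ?p \<le> m"
    by (intro degree_diff_le) (auto simp: degree_monom_le)
  \<comment> \<open>For \<open>m > 0\<close> the constant term does not touch this
    coefficient.\<close>
  have "coeff ?p m = 1" using assms(1) by simp
  then have "?p \<noteq> 0" by force
  have "UNIV - {0} \<subseteq> {x. poly ?p x = 0}"
    using assms(2) by (auto simp: poly_monom)
  then have "card (UNIV - {0::'a}) \<le> card {x. poly ?p x = 0}"
    by (intro card_mono) auto
  also have "\<dots> \<le> m"
    using card_poly_roots_bound[OF \<open>?p \<noteq> 0\<close>] deg by simp
  finally show ?thesis by (simp add: card_Diff_singleton)
qed

lemma inj_power_iff_coprime:
  assumes "r > 0"
  shows "inj (\<lambda>x::'a::{finite,field}. x ^ r) \<longleftrightarrow> coprime r (CARD('a) - 1)"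
proof
  assume inj: "inj (\<lambda>x::'a. x ^ r)"
  define g where "g = gcd r (CARD('a) - 1)"
  have "CARD('a) > 1"
    using card_mono[of UNIV "{0, 1::'a}"] by simp
  then obtain m where m: "CARD('a) - 1 = m * g" and "m > 0"
    unfolding g_def by (metis dvdE gcd_dvd2 mult.commute mult_is_0 neq0_conv zero_less_diff less_irrefl)
  have "x ^ m = 1" if "x \<noteq> 0" for x :: 'a
  proof -
    have "(x ^ m) ^ g = 1"
      using finite_field_power_eq_1[OF that] m by (simp add: power_mult)
    moreover obtain s where "r = g * s"
      unfolding g_def by (metis dvdE gcd_dvd1)
    \<comment> \<open>As \<open>g\<close> divides \<open>r\<close>, the map sends
      \<open>x ^ m\<close> and 1 to the same value.\<close>
    ultimately have "(x ^ m) ^ r = 1 ^ r" by (simp add: power_mult)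
    then show ?thesis using inj by (metis injD)
  qed
  from finite_field_exponent_ge[OF \<open>m > 0\<close> this] have "m * g \<le> m"
    using m by simp
  then have "g \<le> 1" using \<open>m > 0\<close> by simp
  moreover have "g > 0" unfolding g_def using assms by simp
  ultimately have "g = 1" by simp
  then show "coprime r (CARD('a) - 1)"
    unfolding coprime_iff_gcd_eq_1 g_def .
next
  assume cop: "coprime r (CARD('a) - 1)"
  show "inj (\<lambda>x::'a. x ^ r)"
  proof (rule injI)
    fix x y :: 'a
    assume eq: "x ^ r = y ^ r"
    show "x = y"
    proof (cases "x = 0 \<or> y = 0")
      case True
      then show ?thesis using eq assms by (auto simp: power_0_left)
    next
      case False
      \<comment> \<open>The order of \<open>x / y\<close> divides two coprime exponents.\<close>
      then have "(x / y) ^ r = 1" and "(x / y) ^ (CARD('a) - 1) = 1"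
        using eq finite_field_power_eq_1[of "x / y"] by (simp_all add: power_divide)
      then have "(x / y) ^ gcd r (CARD('a) - 1) = 1" by (rule power_gcd_eq_1)
      then show ?thesis using cop False by simp
    qed
  qed
qed

theorem theorem1p3:
  fixes q d r v v\<^sub>1 :: nat and k :: int
    and c :: "'a::{finite,field}" and h f :: "'a poly"
  assumes "primepow q" and "odd q"
    and "CARD('a) = q\<^sup>2"
    and "d > 0" and "[int q = -1] (mod int d)"
    and "c \<noteq> 0"
    and "r > 0"
    and "v = (q + 1) div d" and "v\<^sub>1 = (d - 1) * v"
    and "int v\<^sub>1 + k \<ge> 0" and "int (q * v) + k \<ge> 0"
    and "h = [:c:] + monom 1 (nat (int v\<^sub>1 + k)) - monom 1 (nat (int (q * v) + k))"
    and "f = monom 1 r * pcompose h (monom 1 (q - 1))"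
  shows "permutation_polynomial f \<longleftrightarrow> gcd r (q\<^sup>2 - 1) = 1"
proof -
  have "int d dvd int (q + 1)"
    using assms(5) by (simp add: cong_iff_dvd_diff add.commute)
  then have dv: "d * v = q + 1"
    using assms(8) by (simp only: int_dvd_int_iff dvd_mult_div_cancel)
  \<comment> \<open>Since \<open>d * v\<close> is positive, \<open>v - 1\<close> is a true
    subtraction. With \<open>w = v - 1\<close>, \<open>v\<^sub>1 = q - w\<close>, so
    \<open>q * v - v\<^sub>1 = (q + 1) * w\<close>.\<close>
  then obtain w where w: "v = Suc w" by (cases v) auto
  have "int v\<^sub>1 = int (d * v) - int v"
    using assms(4,9) by (simp add: of_nat_diff algebra_simps)
  then have "int v\<^sub>1 = int q - int w"
    unfolding dv by (simp add: w)
  then have "int (q * v) = int v\<^sub>1 + int ((q + 1) * (v - 1))"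
    using w by (simp add: algebra_simps)
  \<comment> \<open>Nonnegativity of the smaller exponent keeps \<open>nat\<close> from
    truncating.\<close>
  then have e: "nat (int (q * v) + k) = nat (int v\<^sub>1 + k) + (q + 1) * (v - 1)"
    using assms(10) by linarith
  have q: "(q - 1) * (q + 1) = q\<^sup>2 - 1"
    by (simp add: algebra_simps power2_eq_square)
  have "poly f x = c * x ^ r" for x
  proof (cases "x = 0")
    case True
    then show ?thesis using assms(7,13) by (simp add: poly_monom)
  next
    case False
    define z where "z = x ^ (q - 1)"
    have "z ^ (q + 1) = 1"
      using finite_field_power_eq_1[OF False] assms(3) q
      unfolding z_def power_mult[symmetric] by metis
    then have "z ^ ((q + 1) * (v - 1)) = 1"
      by (simp only: power_mult power_one)
    then have "z ^ nat (int (q * v) + k) = z ^ nat (int v\<^sub>1 + k)"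
      by (simp only: e power_add[of z "nat (int v\<^sub>1 + k)"] mult_1_right)
    moreover have "poly f x = x ^ r * (c + z ^ nat (int v\<^sub>1 + k) - z ^ nat (int (q * v) + k))"
      unfolding assms(12,13) z_def by (simp add: poly_pcompose poly_monom)
    ultimately show ?thesis by simp
  qed
  \<comment> \<open>The nonzero factor \<open>c\<close> cancels.\<close>
  then have "inj (poly f) \<longleftrightarrow> inj (\<lambda>x::'a. x ^ r)"
    using assms(6) by (simp add: inj_def)
  also have "\<dots> \<longleftrightarrow> gcd r (q\<^sup>2 - 1) = 1"
    unfolding inj_power_iff_coprime[OF assms(7)] assms(3) coprime_iff_gcd_eq_1 ..
  finally show ?thesis
    unfolding permutation_polynomial_def bij_def using finite_UNIV_inj_surj[of "poly f"] by auto
qed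

end
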